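(* Let $\mathbb{A}$ be a unital $C^*$-algebra, let $(X,\mathbb{A},d)$ be a complete $C^*$-algebra valued metric space, let $\varphi: X\to\mathbb{A}_+$ be a function, let $F\in\mathcal{F}$, and let $T:X\to X$. Suppose that: (a) $\varphi$ is lower semi-continuous; (b) $T$ is a graphic $(F,\varphi)$-contraction with respect to $d$, i.e. there is a real number $k\in(0,1)$ such that $$F(d(T^2x,Tx),\varphi(T^2x),\varphi(Tx))\preceq k\,F(d(Tx,x),\varphi(Tx),\varphi(x))\quad\text{for all }x\in X;$$ (c) $T$ is continuous. Then: (i) $F_T\subseteq Z_\varphi$; (ii) $T$ is a weakly $\varphi$-Picard operator; (iii) for all $x\in X$, if $T^n x\to z$ as $n\to\infty$, then $$d(T^n x,z)\preceq \frac{k^n}{1-k}\,F(d(Tx,x),\varphi(Tx),\varphi(x))\quad\text{for all } n\in\mathbb{N}.$$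
   Context: $\mathbb{A}$ is a unital $C^*$-algebra with zero element $\theta$; $\mathbb{A}_+$ is the set of positive elements (self-adjoint with spectrum in $[0,\infty)$), and for self-adjoint $a,b$, $a\preceq b$ means $b-a\in\mathbb{A}_+$. A $C^*$-algebra valued metric space $(X,\mathbb{A},d)$ is a non-empty set $X$ with $d:X\times X\to\mathbb{A}$ such that for all $x,y,z$: $\theta\preceq d(x,y)$, with $d(x,y)=\theta$ iff $x=y$; $d(x,y)=d(y,x)$; $d(x,y)\preceq d(x,z)+d(z,y)$. Convergence $x_n\to x$ means $\|d(x_n,x)\|\to0$; $(x_n)$ is Cauchy if $\|d(x_n,x_m)\|\to 0$ as $n,m\to\infty$; the space is complete if every Cauchy sequence converges. Continuity of $T$ is with respect to this convergence. $\mathcal{F}$ is the set of functions $F:\mathbb{A}_+^3\to\mathbb{A}_+$ such that (F1) $\max\{x,y\}\preceq F(x,y,z)$ for all $x,y,z\in\mathbb{A}_+$, meaning $x\preceq F(x,y,z)$ and $y\preceq F(x,y,z)$; (F2) $F(\theta,\theta,\theta)=\theta$; (F3) $F$ is (norm) continuous. $\varphi:X\to\mathbb{A}_+$ is lower semi-continuous if $x_n\to x$ in $X$ implies $\|\varphi(x)\|\le\liminf_n\|\varphi(x_n)\|$. $T^0$ is the identity of $X$ and $T^{n+1}=T\circ T^n$. $F_T=\{x\in X: Tx=x\}$ and $Z_\varphi=\{x\in X:\varphi(x)=\theta\}$. A $\varphi$-fixed point of $T$ is an element of $F_T\cap Z_\varphi$. $T$ is a weakly $\varphi$-Picard operator if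 $F_T\cap Z_\varphi\neq\emptyset$ and, for every $x\in X$, the sequence $(T^n x)$ converges and its limit is a $\varphi$-fixed point of $T$. *)

theory Defs
  imports "HOL-Analysis.Analysis"
begin

(* The inherited norm and completeness are those of the underlying real Banach algebra;
   real_normed_algebra_1 carries the usual normalisation norm 1 = 1 of a unital Banach algebra. *)
class cstar_algebra = real_normed_algebra_1 + banach +
  fixes scaleC :: "complex \<Rightarrow> 'a \<Rightarrow> 'a"  (infixr "*\<^sub>C" 75)
    and star :: "'a \<Rightarrow> 'a"
  assumes scaleC_add_right: "c *\<^sub>C (a + b) = c *\<^sub>C a + c *\<^sub>C b"
    and scaleC_add_left: "(c + c') *\<^sub>C a = c *\<^sub>C a + c' *\<^sub>C a"
    and scaleC_scaleC: "c *\<^sub>C (c' *\<^sub>C a) = (c * c') *\<^sub>C a"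
    and scaleC_of_real: "complex_of_real r *\<^sub>C a = r *\<^sub>R a"
    and mult_scaleC_left: "(c *\<^sub>C a) * b = c *\<^sub>C (a * b)"
    and mult_scaleC_right: "a * (c *\<^sub>C b) = c *\<^sub>C (a * b)"
    and norm_scaleC: "norm (c *\<^sub>C a) = cmod c * norm a"
    and star_star: "star (star a) = a"
    and star_add: "star (a + b) = star a + star b"
    and star_scaleC: "star (c *\<^sub>C a) = cnj c *\<^sub>C star a"
    and star_mult: "star (a * b) = star b * star a"
    and cstar_identity: "norm (star a * a) = (norm a)\<^sup>2"

definition spectrum :: "'a::cstar_algebra \<Rightarrow> complex set" where
  "spectrum a = {c. \<not> (\<exists>b. (a - c *\<^sub>C 1) * b = 1 \<and> b * (a - c *\<^sub>C 1) = 1)}"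

definition self_adjoint :: "'a::cstar_algebra \<Rightarrow> bool" where
  "self_adjoint a \<longleftrightarrow> star a = a"

definition positive_cone :: "'a::cstar_algebra set" where
  "positive_cone = {a. self_adjoint a \<and> spectrum a \<subseteq> complex_of_real ` {0..}}"

definition cstar_le :: "'a::cstar_algebra \<Rightarrow> 'a \<Rightarrow> bool"  (infix "\<preceq>" 50) where
  "a \<preceq> b \<longleftrightarrow> self_adjoint a \<and> self_adjoint b \<and> b - a \<in> positive_cone"

definition cstar_metric_space :: "'x set \<Rightarrow> ('x \<Rightarrow> 'x \<Rightarrow> 'a::cstar_algebra) \<Rightarrow> bool" where
  "cstar_metric_space X d \<longleftrightarrow>
     X \<noteq> {} \<and>
     (\<forall>x\<in>X. \<forall>y\<in>X. 0 \<preceq> d x y \<and> (d x y = 0 \<longleftrightarrow> x = y)) \<and>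
     (\<forall>x\<in>X. \<forall>y\<in>X. d x y = d y x) \<and>
     (\<forall>x\<in>X. \<forall>y\<in>X. \<forall>z\<in>X. d x y \<preceq> d x z + d z y)"

definition converges_to :: "('x \<Rightarrow> 'x \<Rightarrow> 'a::cstar_algebra) \<Rightarrow> (nat \<Rightarrow> 'x) \<Rightarrow> 'x \<Rightarrow> bool" where
  "converges_to d s x \<longleftrightarrow> (\<lambda>n. norm (d (s n) x)) \<longlonglongrightarrow> 0"

definition Cauchy_seq :: "('x \<Rightarrow> 'x \<Rightarrow> 'a::cstar_algebra) \<Rightarrow> (nat \<Rightarrow> 'x) \<Rightarrow> bool" where
  "Cauchy_seq d s \<longleftrightarrow> (\<forall>e>0. \<exists>N. \<forall>n\<ge>N. \<forall>m\<ge>N. norm (d (s n) (s m)) < e)"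

definition complete_cstar_metric_space ::
    "'x set \<Rightarrow> ('x \<Rightarrow> 'x \<Rightarrow> 'a::cstar_algebra) \<Rightarrow> bool" where
  "complete_cstar_metric_space X d \<longleftrightarrow>
     cstar_metric_space X d \<and>
     (\<forall>s. range s \<subseteq> X \<longrightarrow> Cauchy_seq d s \<longrightarrow> (\<exists>x\<in>X. converges_to d s x))"

definition seq_continuous ::
    "'x set \<Rightarrow> ('x \<Rightarrow> 'x \<Rightarrow> 'a::cstar_algebra) \<Rightarrow> ('x \<Rightarrow> 'x) \<Rightarrow> bool" where
  "seq_continuous X d T \<longleftrightarrow>
     (\<forall>s x. range s \<subseteq> X \<longrightarrow> x \<in> X \<longrightarrow> converges_to d s x \<longrightarrow>
        converges_to d (\<lambda>n. T (s n)) (T x))"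

definition lower_semicontinuous ::
    "'x set \<Rightarrow> ('x \<Rightarrow> 'x \<Rightarrow> 'a::cstar_algebra) \<Rightarrow> ('x \<Rightarrow> 'a) \<Rightarrow> bool" where
  "lower_semicontinuous X d \<phi> \<longleftrightarrow>
     (\<forall>s x. range s \<subseteq> X \<longrightarrow> x \<in> X \<longrightarrow> converges_to d s x \<longrightarrow>
        ereal (norm (\<phi> x)) \<le> liminf (\<lambda>n. ereal (norm (\<phi> (s n)))))"

(* Only the restriction of F to triples of positive elements is constrained. *)
definition control_functions :: "('a::cstar_algebra \<Rightarrow> 'a \<Rightarrow> 'a \<Rightarrow> 'a) set" where
  "control_functions =
     {F. (\<forall>x\<in>positive_cone. \<forall>y\<in>positive_cone. \<forall>z\<in>positive_cone. F x y z \<in> positive_cone) \<and>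
         (\<forall>x\<in>positive_cone. \<forall>y\<in>positive_cone. \<forall>z\<in>positive_cone.
            x \<preceq> F x y z \<and> y \<preceq> F x y z) \<and>
         F 0 0 0 = 0 \<and>
         continuous_on (positive_cone \<times> positive_cone \<times> positive_cone) (\<lambda>(x, y, z). F x y z)}"

definition graphic_contraction ::
    "'x set \<Rightarrow> ('x \<Rightarrow> 'x \<Rightarrow> 'a::cstar_algebra) \<Rightarrow> ('a \<Rightarrow> 'a \<Rightarrow> 'a \<Rightarrow> 'a) \<Rightarrow> ('x \<Rightarrow> 'a)
      \<Rightarrow> real \<Rightarrow> ('x \<Rightarrow> 'x) \<Rightarrow> bool" where
  "graphic_contraction X d F \<phi> k T \<longleftrightarrow>
     0 < k \<and> k < 1 \<and>
     (\<forall>x\<in>X. F (d (T (T x)) (T x)) (\<phi> (T (T x))) (\<phi> (T x))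
              \<preceq> k *\<^sub>R F (d (T x) x) (\<phi> (T x)) (\<phi> x))"

definition fixed_points :: "'x set \<Rightarrow> ('x \<Rightarrow> 'x) \<Rightarrow> 'x set" where
  "fixed_points X T = {x \<in> X. T x = x}"

definition zeros :: "'x set \<Rightarrow> ('x \<Rightarrow> 'a::cstar_algebra) \<Rightarrow> 'x set" where
  "zeros X \<phi> = {x \<in> X. \<phi> x = 0}"

definition weakly_Picard ::
    "'x set \<Rightarrow> ('x \<Rightarrow> 'x \<Rightarrow> 'a::cstar_algebra) \<Rightarrow> ('x \<Rightarrow> 'a) \<Rightarrow> ('x \<Rightarrow> 'x) \<Rightarrow> bool" where
  "weakly_Picard X d \<phi> T \<longleftrightarrow>
     fixed_points X T \<inter> zeros X \<phi> \<noteq> {} \<and>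
     (\<forall>x\<in>X. \<exists>z \<in> fixed_points X T \<inter> zeros X \<phi>. converges_to d (\<lambda>n. (T ^^ n) x) z)"

end

theory Submission
  imports Defs
begin

text \<open>
  Put \<open>\<Phi> x = F (d (T x) x) (\<phi> (T x)) (\<phi> x)\<close>. The contraction condition reads
  \<open>\<Phi> (T x) \<preceq> k \<Phi> x\<close>, so \<open>\<Phi>\<close> decays geometrically along orbits, and it dominates both
  the step length \<open>d (T x) x\<close> and the value \<open>\<phi> (T x)\<close>. Hence an orbit is a Cauchy sequence with
  the usual geometric tail estimate (\<open>geometric_dist_bound\<close>); by completeness it converges,
  and by continuity of \<open>T\<close> its limit is a fixed point. At a fixed point \<open>\<Phi> x \<preceq> k \<Phi> x\<close> with
  \<open>k < 1\<close> forces \<open>\<Phi> x = 0\<close>, whence \<open>\<phi> x = 0\<close>. Letting the second index of the tail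
  estimate tend to infinity gives the error bound.

  This argument rests on three properties of the order of a \<open>C\<^sup>*\<close>-algebra: positive elements
  are closed under addition (transitivity of the order), they form a norm-closed set (passage to
  the limit), and the norm is monotone on them (from order estimates to norm estimates).
  All three follow once the positive cone, which is defined through the spectrum, is described
  by the norm: a self-adjoint \<open>a\<close> is positive iff \<open>\<parallel>t - a\<parallel> \<le> t\<close> for some
  \<open>t\<close>, and then this holds for every \<open>t \<ge> \<parallel>a\<parallel>\<close> (\<open>positive_coneI_norm\<close>,
  \<open>positive_cone_norm_le\<close>).

  The description needs two facts on self-adjoint elements: their spectrum is real, and
  it contains \<open>\<parallel>a\<parallel>\<close> or \<open>-\<parallel>a\<parallel>\<close> (\<open>norm_in_spectrum\<close>). The second one is the
  spectral radius theorem for self-adjoint elements. It is proved here without vector-valued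
  complex analysis: the identity
  \<open>(1 - a\<^sup>2)\<^sup>-\<^sup>1 = ((1 - a)\<^sup>-\<^sup>1 + (1 + a)\<^sup>-\<^sup>1) / 2\<close> transports an estimate that is uniform on the
  unit circle from \<open>a\<close> to all the powers of \<open>a\<close> with exponent \<open>2\<^sup>m\<close>.
\<close>

section \<open>Scalars and involution\<close>

lemma scaleC_one [simp]: "1 *\<^sub>C a = (a::'a::cstar_algebra)"
  using scaleC_of_real[of 1 a] by simp

lemma scaleC_zero_left [simp]: "0 *\<^sub>C a = (0::'a::cstar_algebra)"
  using scaleC_of_real[of 0 a] by simp

lemma scaleC_minus_left: "(- c) *\<^sub>C a = - (c *\<^sub>C (a::'a::cstar_algebra))"
  using scaleC_add_left[of c "- c" a] by (simp add: eq_neg_iff_add_eq_0 add.commute)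

lemma scaleC_diff_left: "(c - c') *\<^sub>C a = c *\<^sub>C a - c' *\<^sub>C (a::'a::cstar_algebra)"
  using scaleC_add_left[of c "- c'" a] by (simp add: scaleC_minus_left)

lemma scaleC_diff_right: "c *\<^sub>C (a - b) = c *\<^sub>C a - c *\<^sub>C (b::'a::cstar_algebra)"
  using scaleC_add_right[of c "a - b" b] by (simp add: eq_diff_eq)

lemma scaleC_of_real_one: "complex_of_real r *\<^sub>C (1::'a::cstar_algebra) = of_real r"
  by (simp only: scaleC_of_real of_real_def[where 'a = 'a])

lemma star_zero [simp]: "star (0::'a::cstar_algebra) = 0"
  using star_add[of 0 "0::'a"] by simp

lemma star_diff: "star (a - b) = star a - star (b::'a::cstar_algebra)"
  using star_add[of "a - b" b] by (simp add: eq_diff_eq)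

lemma star_one [simp]: "star (1::'a::cstar_algebra) = 1"
  using star_mult[of "star (1::'a)" 1] by (simp add: star_star)

lemma star_scaleR: "star (r *\<^sub>R a) = r *\<^sub>R star (a::'a::cstar_algebra)"
  using star_scaleC[of "complex_of_real r" a] by (simp add: scaleC_of_real)

lemma star_of_real [simp]: "star (of_real r :: 'a::cstar_algebra) = of_real r"
  by (simp add: of_real_def star_scaleR)

lemma norm_star: "norm (star a) = norm (a::'a::cstar_algebra)"
proof -
  \<comment> \<open>The \<open>C\<^sup>*\<close>-identity gives one inequality; applied to \<open>star a\<close> it gives the other.\<close>
  have le: "norm b \<le> norm (star b)" for b :: 'a
  proof (cases "b = 0")
    case False
    have "norm b * norm b \<le> norm (star b) * norm b"
      using cstar_identity[of b] norm_mult_ineq[of "star b" b] by (simp add: power2_eq_square)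
    then show ?thesis using False by simp
  qed simp
  show ?thesis using le[of a] le[of "star a"] by (simp add: star_star)
qed

section \<open>Spectrum of self-adjoint elements\<close>

definition inverse_pair :: "'a::cstar_algebra \<Rightarrow> 'a \<Rightarrow> bool" where
  "inverse_pair a b \<longleftrightarrow> a * b = 1 \<and> b * a = 1"

lemma spectrum_iff: "c \<in> spectrum a \<longleftrightarrow> \<not> (\<exists>b. inverse_pair (a - c *\<^sub>C 1) b)"
  by (simp add: spectrum_def inverse_pair_def)

lemma inverse_pair_scaleC:
  assumes "inverse_pair a b" "c \<noteq> 0"
  shows "inverse_pair (c *\<^sub>C a) ((1 / c) *\<^sub>C b)"
  using assms by (simp add: inverse_pair_def mult_scaleC_left mult_scaleC_right scaleC_scaleC)

lemma inverse_pair_minus: "inverse_pair a b \<Longrightarrow> inverse_pair (- a) (- b)"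
  by (simp add: inverse_pair_def)

text \<open>Neumann series: the inverse is the sum of the powers of \<open>a\<close>.\<close>

lemma inverse_pair_one_minus:
  fixes a :: "'a::cstar_algebra"
  assumes "norm a < 1"
  shows "\<exists>b. inverse_pair (1 - a) b"
proof -
  have s: "summable (\<lambda>n. a ^ n)"
    by (rule complete_algebra_summable_geometric[OF assms])
  have shift: "(\<Sum>n. a ^ n) = 1 + (\<Sum>n. a ^ Suc n)"
    using suminf_split_head[OF s] by simp
  have "(\<Sum>n. a ^ Suc n) = a * (\<Sum>n. a ^ n)"
    using suminf_mult[OF s, of a] by simp
  moreover have "(\<Sum>n. a ^ Suc n) = (\<Sum>n. a ^ n) * a"
    using suminf_mult2[OF s, of a] by (simp add: power_commutes)
  ultimately show ?thesis
    using shift unfolding inverse_pair_def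
    by (intro exI[of _ "\<Sum>n. a ^ n"]) (simp add: algebra_simps)
qed

text \<open>The factors \<open>1 - c a\<close> stay bounded as \<open>c\<close> varies over the closed unit disc, and at
  \<open>c = 0\<close> nothing degenerates. This makes the whole region \<open>\<bar>z\<bar> \<ge> 1\<close>, including the point
  at infinity, accessible to a compactness argument.\<close>

lemma spectrum_inverse_iff:
  assumes "c \<noteq> 0"
  shows "1 / c \<in> spectrum a \<longleftrightarrow> \<not> (\<exists>b. inverse_pair (1 - c *\<^sub>C a) b)"
proof -
  have eq: "(- c) *\<^sub>C (a - (1 / c) *\<^sub>C 1) = 1 - c *\<^sub>C a"
    using assms by (simp add: scaleC_diff_right scaleC_scaleC scaleC_minus_left)
  have eq': "(- (1 / c)) *\<^sub>C (1 - c *\<^sub>C a) = a - (1 / c) *\<^sub>C 1"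
    using assms by (simp add: scaleC_diff_right scaleC_scaleC scaleC_minus_left)
  show ?thesis
    unfolding spectrum_iff
    using inverse_pair_scaleC[of "a - (1 / c) *\<^sub>C 1" _ "- c"]
      inverse_pair_scaleC[of "1 - c *\<^sub>C a" _ "- (1 / c)"] assms
    unfolding eq eq' by auto
qed

text \<open>Beyond the norm, \<open>a / c\<close> has norm below one and the Neumann series inverts \<open>1 - a / c\<close>.\<close>

lemma spectrum_norm_le:
  assumes "c \<in> spectrum a"
  shows "cmod c \<le> norm a"
proof (rule ccontr)
  assume "\<not> ?thesis"
  then have lt: "norm a < cmod c" by simp
  then have c0: "c \<noteq> 0" by (metis norm_ge_zero norm_zero not_less)
  have "norm ((1 / c) *\<^sub>C a) < 1"
    using lt c0 by (simp add: norm_scaleC norm_divide divide_simps)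
  then show False
    using inverse_pair_one_minus spectrum_inverse_iff[of "1 / c" a] assms c0 by auto
qed

lemma spectrum_reflect:
  "complex_of_real r \<in> spectrum (of_real t - a) \<longleftrightarrow> complex_of_real (t - r) \<in> spectrum a"
proof -
  have *: "of_real t - a - complex_of_real r *\<^sub>C 1 = - (a - complex_of_real (t - r) *\<^sub>C 1)"
    unfolding scaleC_of_real_one by simp
  show ?thesis
    unfolding spectrum_iff *
    using inverse_pair_minus by (metis minus_minus)
qed

text \<open>Arens' trick: translate by \<open>\<i> l\<close> with \<open>l\<close> real. The \<open>C\<^sup>*\<close>-identity bounds
  \<open>\<parallel>a + \<i> l\<parallel>\<^sup>2\<close> by \<open>\<parallel>a\<parallel>\<^sup>2 + l\<^sup>2\<close>, while for a spectral value \<open>c\<close> the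
  square \<open>\<bar>c + \<i> l\<bar>\<^sup>2\<close> contains the term \<open>2 l Im c\<close> besides \<open>l\<^sup>2\<close>, which is unbounded in
  \<open>l\<close> unless \<open>c\<close> is real.\<close>

lemma spectrum_self_adjoint_real:
  assumes "self_adjoint a" "c \<in> spectrum a"
  shows "c \<in> \<real>"
proof -
  have bound: "(Re c)\<^sup>2 + (Im c + l)\<^sup>2 \<le> (norm a)\<^sup>2 + l\<^sup>2" for l :: real
  proof -
    let ?i = "\<i> * complex_of_real l" and ?b = "a + (\<i> * complex_of_real l) *\<^sub>C 1"
    have "c + ?i \<in> spectrum ?b"
      using assms(2) by (simp add: spectrum_iff scaleC_add_left)
    then have "(cmod (c + ?i))\<^sup>2 \<le> (norm ?b)\<^sup>2"
      by (intro power_mono spectrum_norm_le) auto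
    also have "\<dots> = norm (star ?b * ?b)" by (simp add: cstar_identity)
    also have "star ?b * ?b = a * a + of_real (l\<^sup>2)"
    proof -
      have st: "star ?b = a - ?i *\<^sub>C 1"
        using assms(1) by (simp add: self_adjoint_def star_add star_scaleC scaleC_minus_left)
      have sq: "?i *\<^sub>C (?i *\<^sub>C (1::'a)) = - of_real (l\<^sup>2)"
      proof -
        have "?i * ?i = - complex_of_real (l\<^sup>2)"
          by (simp add: complex_eq_iff power2_eq_square)
        then show ?thesis
          by (simp only: scaleC_scaleC scaleC_minus_left scaleC_of_real_one)
      qed
      have "star ?b * ?b = a * a - ?i *\<^sub>C (?i *\<^sub>C 1)"
        unfolding st
        by (simp add: algebra_simps mult_scaleC_left mult_scaleC_right scaleC_diff_right)
      then show ?thesis by (simp only: sq diff_minus_eq_add)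
    qed
    also have "norm (a * a + of_real (l\<^sup>2)) \<le> (norm a)\<^sup>2 + l\<^sup>2"
    proof (rule order_trans[OF norm_triangle_ineq add_mono])
      show "norm (a * a) \<le> (norm a)\<^sup>2" by (simp add: power2_eq_square norm_mult_ineq)
      show "norm (of_real (l\<^sup>2) :: 'a) \<le> l\<^sup>2" by (simp del: of_real_power)
    qed
    finally show ?thesis by (simp add: cmod_power2)
  qed
  have "Im c = 0"
  proof (rule ccontr)
    assume n: "Im c \<noteq> 0"
    have "(Re c)\<^sup>2 + (Im c)\<^sup>2 + 2 * Im c * l \<le> (norm a)\<^sup>2" for l
      using bound[of l] by (simp add: power2_eq_square algebra_simps)
    \<comment> \<open>This translation makes the cross term \<open>2 l Im c\<close> equal to \<open>\<parallel>a\<parallel>\<^sup>2 + 1\<close>, already more than the right-hand side.\<close>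
    from this[of "((norm a)\<^sup>2 + 1) / (2 * Im c)"] n
    have "(Re c)\<^sup>2 + (Im c)\<^sup>2 + ((norm a)\<^sup>2 + 1) \<le> (norm a)\<^sup>2" by simp
    then show False using zero_le_power2[of "Re c"] zero_le_power2[of "Im c"] by linarith
  qed
  then show ?thesis by (simp add: complex_is_Real_iff)
qed

text \<open>The resolvent identity \<open>R c - R c0 = (c - c0) R c h R c0\<close> first bounds \<open>\<parallel>R c\<parallel>\<close> by
  \<open>2 \<parallel>R c0\<parallel>\<close> near \<open>c0\<close>, and then bounds the difference itself.\<close>

lemma resolvent_continuous:
  assumes R: "\<And>c. c \<in> S \<Longrightarrow> inverse_pair (1 - c *\<^sub>C h) (R c)"
  shows "continuous_on S R"
  unfolding continuous_on_iff
proof (intro ballI allI impI)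
  fix c0 and e :: real
  assume c0: "c0 \<in> S" and e: "0 < e"
  define M where "M = norm (R c0)"
  define K where "K = norm h"
  have M0: "M \<ge> 0" "K \<ge> 0" by (auto simp: M_def K_def)
  \<comment> \<open>The first bound on the distance gives \<open>\<parallel>R c\<parallel> \<le> 2 M\<close>, the second the final estimate; the summands \<open>1\<close> keep the denominators positive.\<close>
  define dl where "dl = min (1 / (2 * (M * K + 1))) (e / (2 * M * M * K + 1))"
  have den: "0 < 2 * (M * K + 1)" "0 < 2 * M * M * K + 1"
    using M0 by (auto intro: add_nonneg_pos)
  have dl: "dl > 0" unfolding dl_def using den e by auto
  show "\<exists>d>0. \<forall>c\<in>S. dist c c0 < d \<longrightarrow> dist (R c) (R c0) < e"
  proof (intro exI conjI ballI impI, rule dl)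
    fix c assume c: "c \<in> S" and d: "dist c c0 < dl"
    let ?x = "cmod (c - c0)"
    have x: "?x < 1 / (2 * (M * K + 1))" "?x < e / (2 * M * M * K + 1)"
      using d by (auto simp: dl_def dist_norm)
    have eq: "R c - R c0 = (c - c0) *\<^sub>C (R c * h * R c0)"
    proof -
      have "R c * (1 - c0 *\<^sub>C h) * R c0 = R c" "R c * (1 - c *\<^sub>C h) * R c0 = R c0"
        using R[OF c] R[OF c0] unfolding inverse_pair_def
        by (metis mult.assoc mult_1_right, metis mult_1_left)
      then have "R c * ((1 - c0 *\<^sub>C h) - (1 - c *\<^sub>C h)) * R c0 = R c - R c0"
        by (simp only: left_diff_distrib right_diff_distrib)
      moreover have "(1 - c0 *\<^sub>C h) - (1 - c *\<^sub>C h) = (c - c0) *\<^sub>C h"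
        by (simp add: scaleC_diff_left)
      ultimately show ?thesis
        by (simp add: mult_scaleC_left mult_scaleC_right)
    qed
    have "norm (R c - R c0) \<le> ?x * (norm (R c) * K * M)"
      unfolding eq norm_scaleC K_def M_def
      by (intro mult_left_mono order_trans[OF norm_mult_ineq] mult_right_mono norm_mult_ineq) auto
    then have n: "norm (R c - R c0) \<le> ?x * K * M * norm (R c)" by (simp add: mult_ac)
    have "?x * (2 * (M * K + 1)) \<le> 1" using x(1) den by (simp add: field_simps)
    then have half: "?x * K * M \<le> 1 / 2" by (simp add: algebra_simps) (smt (verit) norm_ge_zero)
    have "norm (R c) \<le> M + norm (R c - R c0)"
      using norm_triangle_ineq[of "R c0" "R c - R c0"] by (simp add: M_def)
    moreover have "norm (R c - R c0) \<le> 1 / 2 * norm (R c)"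
      using n mult_right_mono[OF half, of "norm (R c)"] by simp
    ultimately have "norm (R c) \<le> 2 * M" by simp
    then have "norm (R c - R c0) \<le> ?x * K * M * (2 * M)"
      using n M0 by (meson mult_left_mono mult_nonneg_nonneg norm_ge_zero order_trans)
    also have "\<dots> \<le> ?x * (2 * M * M * K + 1)" by (simp add: algebra_simps)
    also have "\<dots> < e" using x(2) den by (simp add: pos_less_divide_eq)
    finally show "dist (R c) (R c0) < e" by (simp add: dist_norm)
  qed
qed

text \<open>The partial fraction decomposition of \<open>1 / (1 - a\<^sup>2)\<close>.\<close>

lemma inverse_pair_square:
  assumes "inverse_pair (1 - a) u" "inverse_pair (1 + a) v"
  shows "inverse_pair (1 - a\<^sup>2) ((1 / 2) *\<^sub>R (u + v))"
proof -
  have f: "1 - a\<^sup>2 = (1 + a) * (1 - a)" "1 - a\<^sup>2 = (1 - a) * (1 + a)"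
    by (simp_all add: power2_eq_square algebra_simps)
  have "(1 - a\<^sup>2) * u = 1 + a" "u * (1 - a\<^sup>2) = 1 + a"
    using assms(1) f unfolding inverse_pair_def
    by (metis mult.assoc mult_1_right, metis mult.assoc mult_1_left)
  moreover have "(1 - a\<^sup>2) * v = 1 - a" "v * (1 - a\<^sup>2) = 1 - a"
    using assms(2) f unfolding inverse_pair_def
    by (metis mult.assoc mult_1_right, metis mult.assoc mult_1_left)
  ultimately show ?thesis
    by (simp add: inverse_pair_def distrib_left distrib_right)
       (metis one_add_one scaleR_half_double)
qed

text \<open>Quantifying over the whole unit circle makes the relation stable under squaring both elements,
  because the circle is closed under square roots and negation.\<close>

definition resolvents_close :: "real \<Rightarrow> 'a::cstar_algebra \<Rightarrow> 'a \<Rightarrow> bool" where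
  "resolvents_close e a b \<longleftrightarrow>
     (\<forall>c. cmod c = 1 \<longrightarrow>
       (\<exists>u v. inverse_pair (1 - c *\<^sub>C a) u \<and> inverse_pair (1 - c *\<^sub>C b) v \<and> norm (u - v) \<le> e))"

text \<open>With \<open>c = w\<^sup>2\<close>, the inverse of \<open>1 - c a\<^sup>2\<close> is the mean of those of \<open>1 - w a\<close> and
  \<open>1 + w a\<close>, and likewise for \<open>b\<close>; the mean of two differences of norm at most \<open>e\<close> has norm at most
  \<open>e\<close>, so the error does not grow.\<close>

lemma resolvents_close_square:
  assumes "resolvents_close e a b"
  shows "resolvents_close e (a\<^sup>2) (b\<^sup>2)"
  unfolding resolvents_close_def
proof (intro allI impI)
  fix c assume c: "cmod c = 1"
  define w where "w = csqrt c"
  have w: "w * w = c" by (simp add: w_def power2_eq_square[symmetric])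
  have "(cmod w)\<^sup>2 = 1" using c w by (simp add: power2_eq_square norm_mult[symmetric])
  then have nw: "cmod w = 1" by (simp add: power2_eq_1_iff) (smt (verit) norm_ge_zero)
  obtain u v where uv: "inverse_pair (1 - w *\<^sub>C a) u" "inverse_pair (1 - w *\<^sub>C b) v"
    "norm (u - v) \<le> e"
    using assms nw unfolding resolvents_close_def by blast
  have "cmod (- w) = 1" using nw by simp
  then obtain u' v' where uv': "inverse_pair (1 - (- w) *\<^sub>C a) u'" "inverse_pair (1 - (- w) *\<^sub>C b) v'"
    "norm (u' - v') \<le> e"
    using assms unfolding resolvents_close_def by blast
  have sq: "c *\<^sub>C (x\<^sup>2) = (w *\<^sub>C x)\<^sup>2" for x :: 'a
    by (simp add: power2_eq_square mult_scaleC_left mult_scaleC_right scaleC_scaleC w)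
  have "inverse_pair (1 - c *\<^sub>C a\<^sup>2) ((1 / 2) *\<^sub>R (u + u'))"
    unfolding sq using uv(1) uv'(1) by (intro inverse_pair_square) (simp_all add: scaleC_minus_left)
  moreover have "inverse_pair (1 - c *\<^sub>C b\<^sup>2) ((1 / 2) *\<^sub>R (v + v'))"
    unfolding sq using uv(2) uv'(2) by (intro inverse_pair_square) (simp_all add: scaleC_minus_left)
  moreover have "norm ((1 / 2) *\<^sub>R (u + u') - (1 / 2) *\<^sub>R (v + v')) \<le> e"
  proof -
    have "(1 / 2) *\<^sub>R (u + u') - (1 / 2) *\<^sub>R (v + v') = (1 / 2) *\<^sub>R ((u - v) + (u' - v'))"
      by (simp add: algebra_simps)
    then show ?thesis
      using norm_triangle_ineq[of "u - v" "u' - v'"] uv(3) uv'(3) by simp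
  qed
  ultimately show "\<exists>u v. inverse_pair (1 - c *\<^sub>C a\<^sup>2) u \<and> inverse_pair (1 - c *\<^sub>C b\<^sup>2) v \<and>
      norm (u - v) \<le> e" by blast
qed

lemma resolvents_close_power:
  assumes "resolvents_close e a b"
  shows "resolvents_close e (a ^ (2 ^ m)) (b ^ (2 ^ m))"
proof (induction m)
  case (Suc m)
  then show ?case
    using resolvents_close_square[OF Suc] by (simp add: power_mult[symmetric] mult.commute)
qed (use assms in simp)

lemma self_adjoint_power: "self_adjoint a \<Longrightarrow> self_adjoint (a ^ n)"
  by (induction n) (simp_all add: self_adjoint_def star_mult power_commutes)

text \<open>For self-adjoint \<open>b\<close> the \<open>C\<^sup>*\<close>-identity reads \<open>\<parallel>b\<^sup>2\<parallel> = \<parallel>b\<parallel>\<^sup>2\<close>; iterate.\<close>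

lemma norm_self_adjoint_power:
  assumes "self_adjoint a"
  shows "norm (a ^ (2 ^ m)) = norm a ^ (2 ^ m)"
proof (induction m)
  case (Suc m)
  have "norm (a ^ (2 ^ Suc m)) = norm (star (a ^ 2 ^ m) * a ^ 2 ^ m)"
    using self_adjoint_power[OF assms] by (simp add: self_adjoint_def power_add[symmetric] mult_2)
  then show ?case
    by (simp add: cstar_identity Suc power_mult[symmetric] mult.commute)
qed simp

text \<open>Otherwise \<open>1 - c h\<close> is invertible for every \<open>c\<close> in the closed unit disc, since the spectrum is
  real and bounded by one. By uniform continuity of the inverse there is an \<open>s < 1\<close> such that
  replacing \<open>h\<close> by \<open>s h\<close> changes the inverses over the unit circle only a little, and the same
  then holds for \<open>h\<^sup>N\<close> and \<open>s\<^sup>N h\<^sup>N\<close> with \<open>N = 2\<^sup>m\<close>. For large \<open>N\<close> the second element is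
  nearly zero, so the inverse of \<open>1 - h\<^sup>N\<close> is near \<open>1\<close> and \<open>\<parallel>h\<^sup>N\<parallel> < 1\<close>, contrary to
  \<open>\<parallel>h\<^sup>N\<parallel> = 1\<close>.\<close>

lemma norm_in_spectrum_unit:
  fixes h :: "'a::cstar_algebra"
  assumes sa: "self_adjoint h" and n1: "norm h = 1"
  shows "1 \<in> spectrum h \<or> - 1 \<in> spectrum h"
proof (rule ccontr)
  assume no: "\<not> ?thesis"
  have ex: "\<exists>b. inverse_pair (1 - c *\<^sub>C h) b" if c: "c \<in> cball 0 1" for c
  proof (cases "c = 0")
    case True
    then show ?thesis by (auto simp: inverse_pair_def)
  next
    case False
    have "1 / c \<notin> spectrum h"
    proof
      assume s: "1 / c \<in> spectrum h"
      then obtain r where r: "1 / c = complex_of_real r"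
        using spectrum_self_adjoint_real[OF sa] Reals_cases by blast
      have "\<bar>r\<bar> \<le> 1" using spectrum_norm_le[OF s] n1 r by simp
      moreover have "\<bar>r\<bar> \<ge> 1"
      proof -
        have "\<bar>r\<bar> = 1 / cmod c" using r by (metis norm_divide norm_of_real norm_one real_norm_def)
        then show ?thesis using c False by simp
      qed
      ultimately have "r = 1 \<or> r = - 1" by linarith
      then show False using s r no by auto
    qed
    then show ?thesis using spectrum_inverse_iff False by blast
  qed
  then obtain R where R: "\<And>c. c \<in> cball 0 1 \<Longrightarrow> inverse_pair (1 - c *\<^sub>C h) (R c)"
    by metis
  have "uniformly_continuous_on (cball 0 1) R"
    by (intro compact_uniformly_continuous resolvent_continuous[where h = h] R) auto
  then obtain \<delta> where \<delta>: "\<delta> > 0"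
    "\<And>c c'. c \<in> cball 0 1 \<Longrightarrow> c' \<in> cball 0 1 \<Longrightarrow> dist c' c < \<delta> \<Longrightarrow> dist (R c') (R c) < 1 / 8"
    unfolding uniformly_continuous_on_def
    by (metis zero_less_divide_1_iff zero_less_numeral)
  define s where "s = 1 - min (1 / 2) (\<delta> / 2)"
  have s: "0 < s" "s < 1" "1 - s < \<delta>" using \<delta>(1) by (auto simp: s_def)
  have close: "resolvents_close (1 / 8) h (s *\<^sub>R h)"
    unfolding resolvents_close_def
  proof (intro allI impI)
    fix c assume c: "cmod c = 1"
    let ?c = "complex_of_real s * c"
    have mem: "c \<in> cball 0 1" "?c \<in> cball 0 1" using c s by (auto simp: norm_mult)
    have "c - ?c = complex_of_real (1 - s) * c" by (simp add: algebra_simps)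
    then have "dist c ?c = 1 - s" using c s by (simp add: dist_norm norm_mult del: of_real_diff)
    then have "norm (R c - R ?c) \<le> 1 / 8"
      using \<delta>(2)[of ?c c] mem s by (auto simp: dist_norm)
    moreover have "c *\<^sub>C (s *\<^sub>R h) = ?c *\<^sub>C h"
      by (simp add: scaleC_of_real[symmetric] scaleC_scaleC mult.commute)
    ultimately show "\<exists>u v. inverse_pair (1 - c *\<^sub>C h) u \<and> inverse_pair (1 - c *\<^sub>C s *\<^sub>R h) v \<and>
        norm (u - v) \<le> 1 / 8"
      using R[OF mem(1)] R[OF mem(2)] by auto
  qed
  obtain m where "s ^ m < 1 / 4" using real_arch_pow_inv[of "1/4" s] s by auto
  moreover have "s ^ (2 ^ m) \<le> s ^ m"
    using s by (intro power_decreasing) (auto simp: less_imp_le)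
  ultimately have sm: "s ^ (2 ^ m) \<le> 1 / 4" by simp
  define g where "g = h ^ (2 ^ m)"
  have ng: "norm g = 1" using norm_self_adjoint_power[OF sa] n1 by (simp add: g_def)
  obtain u v where uv: "inverse_pair (1 - g) u" "inverse_pair (1 - s ^ (2 ^ m) *\<^sub>R g) v"
    "norm (u - v) \<le> 1 / 8"
  proof -
    have "(s *\<^sub>R h) ^ (2 ^ m) = s ^ (2 ^ m) *\<^sub>R g" by (simp add: g_def scaleR_power)
    then show ?thesis
      using resolvents_close_power[OF close, of m] that
      unfolding resolvents_close_def g_def[symmetric] by (metis norm_one scaleC_one)
  qed
  have v1: "norm (v - 1) \<le> 1 / 4 * norm v"
  proof -
    have "v - 1 = s ^ (2 ^ m) *\<^sub>R (g * v)"
      using uv(2) by (simp add: inverse_pair_def algebra_simps)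
    then have "norm (v - 1) = s ^ (2 ^ m) * norm (g * v)" using s by simp
    also have "\<dots> \<le> 1 / 4 * norm v"
      using sm ng norm_mult_ineq[of g v] s by (intro mult_mono) auto
    finally show ?thesis .
  qed
  moreover have "norm v \<le> 1 + norm (v - 1)" using norm_triangle_ineq[of 1 "v - 1"] by simp
  ultimately have "norm (v - 1) \<le> 1 / 3" by simp
  then have u1: "norm (u - 1) \<le> 11 / 24"
    using norm_triangle_ineq[of "u - v" "v - 1"] uv(3) by simp
  \<comment> \<open>As \<open>11 / 24 < 1 / 2\<close>, this identity forces \<open>\<parallel>g\<parallel> < 1\<close>.\<close>
  have "g = (u - 1) - (u - 1) * g"
    using uv(1) by (simp add: inverse_pair_def algebra_simps)
  then have "norm g \<le> norm (u - 1) + norm ((u - 1) * g)"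
    by (metis norm_triangle_ineq4)
  also have "\<dots> \<le> norm (u - 1) + norm (u - 1) * norm g"
    using norm_mult_ineq by (intro add_left_mono) blast
  finally show False using ng u1 by simp
qed

lemma norm_in_spectrum:
  assumes sa: "self_adjoint h"
  shows "\<exists>r. complex_of_real r \<in> spectrum h \<and> \<bar>r\<bar> = norm h"
proof (cases "h = 0")
  case True
  then show ?thesis
    by (intro exI[of _ 0]) (simp add: spectrum_iff inverse_pair_def)
next
  case False
  define t where "t = norm h"
  have t: "t > 0" using False by (simp add: t_def)
  have "self_adjoint ((1 / t) *\<^sub>R h)" using sa by (simp add: self_adjoint_def star_scaleR)
  moreover have "norm ((1 / t) *\<^sub>R h) = 1" using t by (simp add: t_def)
  ultimately obtain e where e: "e = 1 \<or> e = (-1::real)"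
    "complex_of_real e \<in> spectrum ((1 / t) *\<^sub>R h)"
    using norm_in_spectrum_unit by (metis of_real_1 of_real_minus)
  have "complex_of_real (t * e) \<in> spectrum h"
  proof (rule ccontr)
    assume "\<not> ?thesis"
    then obtain b where "inverse_pair (h - complex_of_real (t * e) *\<^sub>C 1) b"
      by (auto simp: spectrum_iff)
    then have "inverse_pair (complex_of_real (1 / t) *\<^sub>C (h - complex_of_real (t * e) *\<^sub>C 1))
        ((1 / complex_of_real (1 / t)) *\<^sub>C b)"
      using t by (intro inverse_pair_scaleC) auto
    moreover have "complex_of_real (1 / t) *\<^sub>C (h - complex_of_real (t * e) *\<^sub>C 1) =
        (1 / t) *\<^sub>R h - complex_of_real e *\<^sub>C 1"
      unfolding scaleC_of_real using t by (simp add: scaleR_diff_right)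
    ultimately show False using e(2) by (auto simp: spectrum_iff)
  qed
  then show ?thesis using e(1) t by (intro exI[of _ "t * e"]) (auto simp: t_def)
qed

section \<open>The positive cone\<close>

lemma positive_coneD: "a \<in> positive_cone \<Longrightarrow> self_adjoint a"
  by (simp add: positive_cone_def)

lemma positive_cone_iff:
  assumes "self_adjoint a"
  shows "a \<in> positive_cone \<longleftrightarrow> (\<forall>r. complex_of_real r \<in> spectrum a \<longrightarrow> 0 \<le> r)"
proof
  assume "a \<in> positive_cone"
  then show "\<forall>r. complex_of_real r \<in> spectrum a \<longrightarrow> 0 \<le> r"
    by (fastforce simp: positive_cone_def)
next
  assume r: "\<forall>r. complex_of_real r \<in> spectrum a \<longrightarrow> 0 \<le> r"
  then show "a \<in> positive_cone"
    using spectrum_self_adjoint_real[OF assms] assms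
    unfolding positive_cone_def by (force elim!: Reals_cases)
qed

lemma self_adjoint_reflect: "self_adjoint a \<Longrightarrow> self_adjoint (of_real t - a)"
  by (simp add: self_adjoint_def star_diff)

text \<open>The norm of \<open>t - a\<close> is the modulus of one of its spectral values, and these are \<open>t - r\<close> with
  \<open>0 \<le> r \<le> t\<close>.\<close>

lemma positive_cone_norm_le:
  assumes "a \<in> positive_cone" "norm a \<le> t"
  shows "norm (of_real t - a) \<le> t"
proof -
  note sa = positive_coneD[OF assms(1)]
  obtain r where r: "complex_of_real r \<in> spectrum (of_real t - a)" "\<bar>r\<bar> = norm (of_real t - a)"
    using norm_in_spectrum[OF self_adjoint_reflect[OF sa]] by blast
  then have "complex_of_real (t - r) \<in> spectrum a" by (simp only: spectrum_reflect)
  then have "0 \<le> t - r" "\<bar>t - r\<bar> \<le> norm a"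
    using assms(1) spectrum_norm_le[of "complex_of_real (t - r)" a] positive_cone_iff[OF sa]
    by (auto simp del: of_real_diff)
  then show ?thesis using r(2) assms(2) by linarith
qed

text \<open>The converse of the preceding criterion, for a single \<open>t\<close>: a spectral value \<open>r\<close> of \<open>a\<close> satisfies
  \<open>\<bar>t - r\<bar> \<le> t\<close>, so it cannot be negative.\<close>

lemma positive_coneI_norm:
  assumes "self_adjoint a" "norm (of_real t - a) \<le> t"
  shows "a \<in> positive_cone"
  unfolding positive_cone_iff[OF assms(1)]
proof (intro allI impI)
  fix r assume "complex_of_real r \<in> spectrum a"
  then have "complex_of_real (t - r) \<in> spectrum (of_real t - a)"
    unfolding spectrum_reflect by simp
  then have "\<bar>t - r\<bar> \<le> norm (of_real t - a)"
    using spectrum_norm_le by (metis norm_of_real real_norm_def)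
  then show "0 \<le> r" using assms(2) by linarith
qed

text \<open>The norm criterion turns this into the triangle inequality, with \<open>t = \<parallel>a\<parallel> + \<parallel>b\<parallel>\<close>.\<close>

lemma positive_cone_add:
  assumes "a \<in> positive_cone" "b \<in> positive_cone"
  shows "a + b \<in> positive_cone"
proof (rule positive_coneI_norm)
  show "self_adjoint (a + b)"
    using assms[THEN positive_coneD] by (simp add: self_adjoint_def star_add)
  have "of_real (norm a + norm b) - (a + b) = (of_real (norm a) - a) + (of_real (norm b) - b)"
    by simp
  then show "norm (of_real (norm a + norm b) - (a + b)) \<le> norm a + norm b"
    using norm_triangle_mono[OF assms[THEN positive_cone_norm_le[OF _ order_refl]]] by metis
qed

lemma positive_cone_scaleR:
  assumes "a \<in> positive_cone" "0 \<le> r"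
  shows "r *\<^sub>R a \<in> positive_cone"
proof (rule positive_coneI_norm)
  show "self_adjoint (r *\<^sub>R a)"
    using assms(1)[THEN positive_coneD] by (simp add: self_adjoint_def star_scaleR)
  have "of_real (r * norm a) - r *\<^sub>R a = r *\<^sub>R (of_real (norm a) - a)"
    by (simp add: scaleR_diff_right of_real_def)
  then show "norm (of_real (r * norm a) - r *\<^sub>R a) \<le> r * norm a"
    using positive_cone_norm_le[OF assms(1) order_refl] assms(2) by (simp add: mult_left_mono)
qed

lemma positive_cone_zero: "0 \<in> positive_cone"
  by (rule positive_coneI_norm[of _ 0]) (simp_all add: self_adjoint_def)

text \<open>With \<open>t = \<parallel>a\<parallel>\<close> the norm criterion compares two continuous functions of \<open>a\<close>, and
  self-adjointness passes to the limit because the involution is isometric.\<close>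

lemma positive_cone_limit:
  assumes "\<And>n. s n \<in> positive_cone" "s \<longlonglongrightarrow> a"
  shows "a \<in> positive_cone"
proof (rule positive_coneI_norm)
  have "(\<lambda>n. star (s n)) \<longlonglongrightarrow> star a"
    using assms(2) by (simp add: tendsto_iff dist_norm star_diff[symmetric] norm_star)
  moreover have "(\<lambda>n. star (s n)) = s"
    using assms(1)[THEN positive_coneD] by (auto simp: self_adjoint_def)
  ultimately show "self_adjoint a"
    using assms(2) LIMSEQ_unique by (auto simp: self_adjoint_def)
  show "norm (of_real (norm a) - a) \<le> norm a"
    by (rule LIMSEQ_le[where X = "\<lambda>n. norm (of_real (norm (s n)) - s n)" and Y = "\<lambda>n. norm (s n)"])
       (use assms(1) positive_cone_norm_le in \<open>auto intro!: tendsto_intros assms(2)\<close>)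
qed

text \<open>From \<open>b \<preceq> \<parallel>b\<parallel>\<close> follows \<open>a \<preceq> \<parallel>b\<parallel>\<close>, so the spectral values of \<open>a\<close>, one of which is
  \<open>\<parallel>a\<parallel>\<close>, are at most \<open>\<parallel>b\<parallel>\<close>.\<close>

lemma positive_cone_norm_mono:
  assumes "a \<in> positive_cone" "b - a \<in> positive_cone"
  shows "norm a \<le> norm b"
proof -
  have b: "b \<in> positive_cone" using positive_cone_add[OF assms] by simp
  note sb = positive_coneD[OF b] and sa = positive_coneD[OF assms(1)]
  have "of_real (norm b) - b \<in> positive_cone"
    unfolding positive_cone_iff[OF self_adjoint_reflect[OF sb]] spectrum_reflect
  proof (intro allI impI)
    fix r assume "complex_of_real (norm b - r) \<in> spectrum b"
    then have "\<bar>norm b - r\<bar> \<le> norm b"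
      using spectrum_norm_le by (metis norm_of_real real_norm_def)
    then show "0 \<le> r" by linarith
  qed
  from positive_cone_add[OF this assms(2)]
  have ba: "of_real (norm b) - a \<in> positive_cone" by simp
  obtain r where r: "complex_of_real r \<in> spectrum a" "\<bar>r\<bar> = norm a"
    using norm_in_spectrum[OF sa] by blast
  then have "0 \<le> r" using assms(1) positive_cone_iff[OF sa] by blast
  moreover have "complex_of_real (norm b - r) \<in> spectrum (of_real (norm b) - a)"
    using r(1) unfolding spectrum_reflect by simp
  then have "0 \<le> norm b - r" using ba positive_cone_iff[OF positive_coneD[OF ba]] by blast
  ultimately show ?thesis using r(2) by linarith
qed

lemma cstar_le_trans: "a \<preceq> b \<Longrightarrow> b \<preceq> c \<Longrightarrow> a \<preceq> c"
  unfolding cstar_le_def using positive_cone_add[of "b - a" "c - b"] by auto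

lemma cstar_le_add: "a \<preceq> b \<Longrightarrow> a' \<preceq> b' \<Longrightarrow> a + a' \<preceq> b + b'"
  unfolding cstar_le_def using positive_cone_add[of "b - a" "b' - a'"]
  by (auto simp: self_adjoint_def star_add algebra_simps)

lemma cstar_le_scaleR: "a \<preceq> b \<Longrightarrow> 0 \<le> r \<Longrightarrow> r *\<^sub>R a \<preceq> r *\<^sub>R b"
  unfolding cstar_le_def using positive_cone_scaleR[of "b - a" r]
  by (auto simp: self_adjoint_def star_scaleR scaleR_diff_right)

lemma cstar_le_refl: "self_adjoint a \<Longrightarrow> a \<preceq> a"
  by (simp add: cstar_le_def positive_cone_zero)

lemma zero_cstar_le_iff: "0 \<preceq> a \<longleftrightarrow> a \<in> positive_cone"
  by (auto simp: cstar_le_def self_adjoint_def positive_cone_def)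

lemma cstar_le_norm_mono: "a \<in> positive_cone \<Longrightarrow> a \<preceq> b \<Longrightarrow> norm a \<le> norm b"
  by (simp add: cstar_le_def positive_cone_norm_mono)

lemma cstar_le_scaleR_right:
  assumes "a \<in> positive_cone" "r \<le> t"
  shows "r *\<^sub>R a \<preceq> t *\<^sub>R a"
  using assms positive_cone_scaleR[of a "t - r"] positive_coneD[of a]
  by (auto simp: cstar_le_def self_adjoint_def star_scaleR scaleR_diff_left)

section \<open>Convergence in algebra-valued metric spaces\<close>

lemma cstar_metricD:
  assumes "cstar_metric_space X d" "x \<in> X" "y \<in> X"
  shows "d x y \<in> positive_cone" "d x y = 0 \<longleftrightarrow> x = y" "d x y = d y x"
    and "z \<in> X \<Longrightarrow> d x y \<preceq> d x z + d z y"
  using assms unfolding cstar_metric_space_def zero_cstar_le_iff[symmetric] by blast+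

lemma cstar_metric_norm_triangle:
  assumes "cstar_metric_space X d" "x \<in> X" "y \<in> X" "z \<in> X"
  shows "norm (d x y) \<le> norm (d x z) + norm (d z y)"
  using cstar_le_norm_mono[OF cstar_metricD(1)[OF assms(1-3)] cstar_metricD(4)[OF assms]]
  by (rule order_trans) (rule norm_triangle_ineq)

lemma converges_to_unique:
  assumes M: "cstar_metric_space X d" and X: "range s \<subseteq> X" "x \<in> X" "y \<in> X"
    and lim: "converges_to d s x" "converges_to d s y"
  shows "x = y"
proof -
  have "(\<lambda>n. norm (d (s n) x) + norm (d (s n) y)) \<longlonglongrightarrow> 0 + 0"
    using lim unfolding converges_to_def by (intro tendsto_add)
  moreover have "norm (d x y) \<le> norm (d (s n) x) + norm (d (s n) y)" for n
    using cstar_metric_norm_triangle[OF M X(2,3), of "s n"] cstar_metricD(3)[OF M X(2), of "s n"] X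
    by auto
  ultimately have "norm (d x y) \<le> 0"
    by (intro LIMSEQ_le_const[where X = "\<lambda>n. norm (d (s n) x) + norm (d (s n) y)"]) auto
  then show ?thesis using cstar_metricD(2)[OF M X(2,3)] by simp
qed

text \<open>The elements \<open>b + d (s m) z - d x z\<close> are positive by the triangle inequality and tend to
  \<open>b - d x z\<close>; the positive cone is closed.\<close>

lemma cstar_le_dist_limit:
  assumes M: "cstar_metric_space X d" and X: "range s \<subseteq> X" "x \<in> X" "z \<in> X"
    and b: "self_adjoint b" "\<And>m. d x (s m) \<preceq> b" and lim: "converges_to d s z"
  shows "d x z \<preceq> b"
proof -
  have "b + d (s m) z - d x z \<in> positive_cone" for m
  proof -
    have sm: "s m \<in> X" using X by auto
    have "d x z \<preceq> d x (s m) + d (s m) z" using cstar_metricD(4)[OF M X(2,3) sm] .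
    moreover have "d x (s m) + d (s m) z \<preceq> b + d (s m) z"
      by (intro cstar_le_add b(2) cstar_le_refl positive_coneD cstar_metricD(1)[OF M sm X(3)])
    ultimately have "d x z \<preceq> b + d (s m) z" by (rule cstar_le_trans)
    then show ?thesis by (simp add: cstar_le_def)
  qed
  moreover have "(\<lambda>m. b + d (s m) z - d x z) \<longlonglongrightarrow> b + 0 - d x z"
    using lim unfolding converges_to_def by (intro tendsto_intros) (rule tendsto_norm_zero_cancel)
  ultimately have "b - d x z \<in> positive_cone" using positive_cone_limit by fastforce
  then show ?thesis
    using b(1) positive_coneD[OF cstar_metricD(1)[OF M X(2,3)]] by (simp add: cstar_le_def)
qed

section \<open>Picard iteration\<close>

text \<open>Add up the steps by the triangle inequality and bound the finite geometric sum by the full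
  series.\<close>

lemma geometric_dist_bound:
  assumes M: "cstar_metric_space X d" and X: "range s \<subseteq> X"
    and p: "p \<in> positive_cone" and k: "0 < k" "k < (1::real)"
    and step: "\<And>n. d (s (Suc n)) (s n) \<preceq> k ^ n *\<^sub>R p"
  shows "d (s n) (s (n + m)) \<preceq> (k ^ n / (1 - k)) *\<^sub>R p"
proof -
  have sX: "s i \<in> X" for i using X by auto
  have "d (s n) (s (n + m)) \<preceq> (\<Sum>j<m. k ^ (n + j)) *\<^sub>R p"
  proof (induction m)
    case 0
    then show ?case
      using cstar_metricD(2)[OF M sX[of n] sX[of n]] by (simp add: cstar_le_refl self_adjoint_def)
  next
    case (Suc m)
    have "d (s n) (s (n + Suc m)) \<preceq> d (s n) (s (n + m)) + d (s (n + m)) (s (n + Suc m))"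
      using cstar_metricD(4)[OF M] sX by blast
    moreover have "d (s (n + m)) (s (n + Suc m)) \<preceq> k ^ (n + m) *\<^sub>R p"
      using step[of "n + m"] cstar_metricD(3)[OF M sX sX] by simp
    ultimately have "d (s n) (s (n + Suc m)) \<preceq> (\<Sum>j<m. k ^ (n + j)) *\<^sub>R p + k ^ (n + m) *\<^sub>R p"
      using cstar_le_add[OF Suc] cstar_le_trans by blast
    then show ?case by (simp add: scaleR_add_left)
  qed
  moreover have "(\<Sum>j<m. k ^ (n + j)) \<le> k ^ n / (1 - k)"
  proof -
    have "(\<Sum>j<m. k ^ (n + j)) = k ^ n * (\<Sum>j<m. k ^ j)"
      by (simp add: power_add sum_distrib_left)
    also have "(\<Sum>j<m. k ^ j) = (1 - k ^ m) / (1 - k)"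
      using sum_gp_strict[of k m] k by simp
    also have "k ^ n * ((1 - k ^ m) / (1 - k)) \<le> k ^ n * (1 / (1 - k))"
      using k by (intro mult_left_mono divide_right_mono) auto
    finally show ?thesis by simp
  qed
  ultimately show ?thesis
    using cstar_le_scaleR_right[OF p] cstar_le_trans by blast
qed

lemma Cauchy_seqI_tail:
  assumes M: "cstar_metric_space X d" and X: "range s \<subseteq> X"
    and bound: "\<And>n m. norm (d (s n) (s (n + m))) \<le> r n" and r: "r \<longlonglongrightarrow> 0"
  shows "Cauchy_seq d s"
  unfolding Cauchy_seq_def
proof (intro allI impI)
  fix e :: real assume "e > 0"
  then have "\<forall>\<^sub>F n in sequentially. r n < e" using r order_tendstoD(2) by blast
  then obtain N where N: "\<And>n. n \<ge> N \<Longrightarrow> r n < e" by (auto simp: eventually_sequentially)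
  have "norm (d (s n) (s m)) < e" if "n \<ge> N" "m \<ge> N" for n m
  proof (cases "n \<le> m")
    case True
    then show ?thesis using bound[of n "m - n"] N[OF that(1)] by simp
  next
    case False
    then have "norm (d (s m) (s n)) < e" using bound[of m "n - m"] N[OF that(2)] by simp
    moreover have "s n \<in> X" "s m \<in> X" using X by auto
    ultimately show ?thesis using cstar_metricD(3)[OF M, of "s n" "s m"] by simp
  qed
  then show "\<exists>N. \<forall>n\<ge>N. \<forall>m\<ge>N. norm (d (s n) (s m)) < e" by blast
qed

theorem theorem3p11:
  fixes X :: "'x set"
    and d :: "'x \<Rightarrow> 'x \<Rightarrow> 'a::cstar_algebra"
    and \<phi> :: "'x \<Rightarrow> 'a"
    and F :: "'a \<Rightarrow> 'a \<Rightarrow> 'a \<Rightarrow> 'a"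
    and T :: "'x \<Rightarrow> 'x"
    and k :: real
  assumes "complete_cstar_metric_space X d"
    and "\<phi> \<in> X \<rightarrow> positive_cone"
    and "F \<in> control_functions"
    and "T \<in> X \<rightarrow> X"
    and "lower_semicontinuous X d \<phi>"
    and "graphic_contraction X d F \<phi> k T"
    and "seq_continuous X d T"
  shows "fixed_points X T \<subseteq> zeros X \<phi>
       \<and> weakly_Picard X d \<phi> T
       \<and> (\<forall>x\<in>X. \<forall>z\<in>X. converges_to d (\<lambda>n. (T ^^ n) x) z \<longrightarrow>
            (\<forall>n. d ((T ^^ n) x) z \<preceq> (k ^ n / (1 - k)) *\<^sub>R F (d (T x) x) (\<phi> (T x)) (\<phi> x)))"
proof -
  have M: "cstar_metric_space X d"
    using assms(1) by (simp add: complete_cstar_metric_space_def)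
  have \<phi>: "\<phi> x \<in> positive_cone" and T: "T x \<in> X" if "x \<in> X" for x
    using assms(2,4) that by auto
  define \<Phi> where "\<Phi> x = F (d (T x) x) (\<phi> (T x)) (\<phi> x)" for x
  have pos: "\<Phi> x \<in> positive_cone" and dist_le: "d (T x) x \<preceq> \<Phi> x" and \<phi>_le: "\<phi> (T x) \<preceq> \<Phi> x"
    if "x \<in> X" for x
    using assms(3) cstar_metricD(1)[OF M T[OF that] that] \<phi>[OF that] \<phi>[OF T[OF that]]
    unfolding control_functions_def \<Phi>_def by blast+
  have k: "0 < k" "k < 1" and contr: "\<And>x. x \<in> X \<Longrightarrow> \<Phi> (T x) \<preceq> k *\<^sub>R \<Phi> x"
    using assms(6) unfolding graphic_contraction_def \<Phi>_def by auto
  have orbit: "(T ^^ n) x \<in> X" if "x \<in> X" for n x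
    by (induction n) (auto simp: that T)
  have decay: "\<Phi> ((T ^^ n) x) \<preceq> k ^ n *\<^sub>R \<Phi> x" if x: "x \<in> X" for n x
  proof (induction n)
    case 0
    then show ?case using pos[OF x] by (simp add: cstar_le_refl positive_coneD)
  next
    case (Suc n)
    have "\<Phi> ((T ^^ Suc n) x) \<preceq> k *\<^sub>R \<Phi> ((T ^^ n) x)" using contr[OF orbit[OF x]] by simp
    moreover have "k *\<^sub>R \<Phi> ((T ^^ n) x) \<preceq> k *\<^sub>R k ^ n *\<^sub>R \<Phi> x"
      using cstar_le_scaleR[OF Suc] k by simp
    ultimately show ?case using cstar_le_trans by fastforce
  qed
  have fixed: "fixed_points X T \<subseteq> zeros X \<phi>"
  proof
    fix x assume "x \<in> fixed_points X T"
    then have x: "x \<in> X" "T x = x" by (auto simp: fixed_points_def)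
    \<comment> \<open>At a fixed point the contraction compares \<open>\<Phi> x\<close> with its own multiple, so its norm vanishes.\<close>
    have "norm (\<Phi> x) \<le> norm (k *\<^sub>R \<Phi> x)"
      using cstar_le_norm_mono[OF pos contr] x by metis
    then have "(1 - k) * norm (\<Phi> x) \<le> 0" using k by (simp add: algebra_simps)
    then have "norm (\<Phi> x) \<le> 0" using k by (simp add: mult_le_0_iff)
    moreover have "norm (\<phi> x) \<le> norm (\<Phi> x)"
      using cstar_le_norm_mono[OF \<phi>[OF x(1)]] \<phi>_le[OF x(1)] x(2) by simp
    ultimately show "x \<in> zeros X \<phi>" using x by (simp add: zeros_def)
  qed
  have bound: "d ((T ^^ n) x) ((T ^^ (n + m)) x) \<preceq> (k ^ n / (1 - k)) *\<^sub>R \<Phi> x"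
    if x: "x \<in> X" for x n m
  proof (rule geometric_dist_bound[OF M _ pos[OF x] k, where s = "\<lambda>n. (T ^^ n) x"])
    show "range (\<lambda>n. (T ^^ n) x) \<subseteq> X" using orbit[OF x] by auto
    show "d ((T ^^ Suc i) x) ((T ^^ i) x) \<preceq> k ^ i *\<^sub>R \<Phi> x" for i
      using cstar_le_trans[OF dist_le[OF orbit[OF x]] decay[OF x]] by simp
  qed
  have conv: "\<exists>z \<in> fixed_points X T \<inter> zeros X \<phi>. converges_to d (\<lambda>n. (T ^^ n) x) z"
    if x: "x \<in> X" for x
  proof -
    let ?s = "\<lambda>n. (T ^^ n) x"
    have ran: "range ?s \<subseteq> X" using orbit[OF x] by auto
    have k0: "(\<lambda>n. k ^ n) \<longlonglongrightarrow> 0" using k by (intro LIMSEQ_realpow_zero) auto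
    have "Cauchy_seq d ?s"
    proof (rule Cauchy_seqI_tail[OF M ran])
      show "norm (d (?s n) (?s (n + m))) \<le> norm ((k ^ n / (1 - k)) *\<^sub>R \<Phi> x)" for n m
        by (rule cstar_le_norm_mono[OF cstar_metricD(1)[OF M orbit[OF x] orbit[OF x]] bound[OF x]])
      have "(\<lambda>n. norm ((k ^ n / (1 - k)) *\<^sub>R \<Phi> x)) \<longlonglongrightarrow> norm ((0 / (1 - k)) *\<^sub>R \<Phi> x)"
        using k by (intro tendsto_intros k0) auto
      then show "(\<lambda>n. norm ((k ^ n / (1 - k)) *\<^sub>R \<Phi> x)) \<longlonglongrightarrow> 0" by simp
    qed
    then obtain z where z: "z \<in> X" "converges_to d ?s z"
      using assms(1) ran unfolding complete_cstar_metric_space_def by blast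
    have "converges_to d (\<lambda>n. T (?s n)) (T z)"
      using assms(7) ran z unfolding seq_continuous_def by blast
    moreover have "converges_to d (\<lambda>n. T (?s n)) z"
      using LIMSEQ_Suc[of "\<lambda>n. norm (d (?s n) z)" 0] z(2) by (simp add: converges_to_def)
    moreover have "range (\<lambda>n. T (?s n)) \<subseteq> X" using ran T by auto
    ultimately have "T z = z" using converges_to_unique[OF M _ T[OF z(1)] z(1)] by blast
    then have "z \<in> fixed_points X T" using z(1) by (simp add: fixed_points_def)
    then show ?thesis using z(2) fixed by blast
  qed
  have "X \<noteq> {}" using M by (simp add: cstar_metric_space_def)
  then have "weakly_Picard X d \<phi> T"
    unfolding weakly_Picard_def using conv by fastforce
  moreover have "d ((T ^^ n) x) z \<preceq> (k ^ n / (1 - k)) *\<^sub>R \<Phi> x"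
    if x: "x \<in> X" and z: "z \<in> X" "converges_to d (\<lambda>n. (T ^^ n) x) z" for x z n
  proof (rule cstar_le_dist_limit[OF M _ orbit[OF x] z(1), where s = "\<lambda>m. (T ^^ (n + m)) x"])
    show "range (\<lambda>m. (T ^^ (n + m)) x) \<subseteq> X" using orbit[OF x] by auto
    show "self_adjoint ((k ^ n / (1 - k)) *\<^sub>R \<Phi> x)"
      using positive_coneD[OF pos[OF x]] by (simp add: self_adjoint_def star_scaleR)
    show "d ((T ^^ n) x) ((T ^^ (n + m)) x) \<preceq> (k ^ n / (1 - k)) *\<^sub>R \<Phi> x" for m
      by (rule bound[OF x])
    show "converges_to d (\<lambda>m. (T ^^ (n + m)) x) z"
      using z(2) LIMSEQ_ignore_initial_segment[of "\<lambda>m. norm (d ((T ^^ m) x) z)" 0 n]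
      by (simp add: converges_to_def add.commute)
  qed
  ultimately show ?thesis using fixed unfolding \<Phi>_def by blast
qed

end
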